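(* Let $0 \ne \eta \in \text{c}_{\text{o}}^*$. If $\eta$ satisfies the exponential $\Delta_2$-condition, then $\eta_{a^p}$ satisfies the exponential $\Delta_2$-condition for every $p \in \mathbb N$.
   Context: $\text{c}_{\text{o}}^*$ is the set of nonnegative real sequences $\xi = (\xi_n)_{n\ge 1}$ that are nonincreasing and converge to $0$. For $\xi\in \text{c}_{\text{o}}^*$, $(\xi_a)_n := \frac1n\sum_{j=1}^n \xi_j$, and $\xi_{a^p}$ is the sequence obtained by applying $\xi\mapsto\xi_a$ $p$ times. A nonzero $\eta\in \text{c}_{\text{o}}^*$ satisfies the exponential $\Delta_2$-condition if $\sup_{m\ge1} \frac{m^2(\eta_a)_{m^2}}{m(\eta_a)_m} < \infty$, i.e., $\sum_{i=1}^{m^2}\eta_i\le c\sum_{i=1}^m\eta_i$ for some $c>0$ and all $m \ge 1$. *)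

theory Defs
  imports "HOL-Analysis.Analysis"
begin

text \<open>
  Sequences are indexed by the positive integers: the value of a function
  \<open>\<xi> :: nat \<Rightarrow> real\<close> at \<open>0\<close> is irrelevant, so
  every condition below (being nonzero included) is restricted to indices
  \<open>n \<ge> 1\<close>.
\<close>

definition c0star :: "(nat \<Rightarrow> real) set" where
  "c0star = {\<xi>. (\<forall>n\<ge>1. 0 \<le> \<xi> n) \<and> antimono_on {1..} \<xi> \<and> \<xi> \<longlonglongrightarrow> 0}"

definition nonzero_seq :: "(nat \<Rightarrow> real) \<Rightarrow> bool" where
  "nonzero_seq \<xi> \<longleftrightarrow> (\<exists>n\<ge>1. \<xi> n \<noteq> 0)"

definition arith_mean :: "(nat \<Rightarrow> real) \<Rightarrow> nat \<Rightarrow> real" where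
  "arith_mean \<xi> n = (1 / real n) * (\<Sum>j=1..n. \<xi> j)"

text \<open>
  The condition is only meaningful for nonzero elements of \<open>c0star\<close>, for which all
  denominators are positive (\<open>\<xi> 1 > 0\<close>); this domain is part of the definition.
  Since the quotients are real, finiteness of the supremum is boundedness above.
\<close>

definition exp_Delta2 :: "(nat \<Rightarrow> real) \<Rightarrow> bool" where
  "exp_Delta2 \<eta> \<longleftrightarrow> \<eta> \<in> c0star \<and> nonzero_seq \<eta> \<and>
     bdd_above ((\<lambda>m. (real (m\<^sup>2) * arith_mean \<eta> (m\<^sup>2)) / (real m * arith_mean \<eta> m)) ` {1..})"

end

theory Submission
  imports Defs
begin

text \<open>
  Write \<open>S n\<close> for the sum \<open>\<eta> 1 + \<dots> + \<eta> n\<close>; the exponential condition says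
  \<open>S (m\<^sup>2) \<le> c * S m\<close>. By induction on \<open>p\<close> it is enough to pass from \<open>\<eta>\<close> to its
  mean sequence \<open>\<eta>\<^sub>a\<close>, where \<open>\<eta>\<^sub>a n = S n / n\<close>.
  Taking means preserves nonnegativity, monotonicity, convergence to 0
  (Cesaro) and the first entry, so only the growth of the partial sums of \<open>\<eta>\<^sub>a\<close>
  is at stake.

  Cut the indices at the perfect squares. The block from \<open>k\<^sup>2\<close> up to, but excluding,
  \<open>(k + 1)\<^sup>2\<close> has \<open>2 * k + 1 \<le> 3 * k\<close> elements, and since \<open>\<eta>\<^sub>a\<close> is nonincreasing each of its
  terms is at most \<open>\<eta>\<^sub>a (k\<^sup>2) = S (k\<^sup>2) / k\<^sup>2 \<le> c * S k / k\<^sup>2\<close>. The whole block therefore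
  contributes at most \<open>3 * c * S k / k\<close>, which is \<open>3 * c\<close> times the single term \<open>\<eta>\<^sub>a k\<close>.
  Summing over \<open>k \<le> m\<close> bounds the partial sum of \<open>\<eta>\<^sub>a\<close> up to \<open>m\<^sup>2\<close> by
  \<open>3 * c\<close> times the one up to \<open>m\<close>.
\<close>

lemma mult_arith_mean: "real n * arith_mean \<xi> n = (\<Sum>j=1..n. \<xi> j)"
  by (cases "n = 0") (auto simp: arith_mean_def)

lemma arith_mean_nonneg:
  assumes "\<And>n. n \<ge> 1 \<Longrightarrow> 0 \<le> \<xi> n"
  shows "0 \<le> arith_mean \<xi> n"
  unfolding arith_mean_def using assms by (intro mult_nonneg_nonneg sum_nonneg) auto

lemma antimono_on_arith_mean:
  assumes "antimono_on {1..} \<xi>"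
  shows "antimono_on {1..} (arith_mean \<xi>)"
proof -
  have mean_Suc: "arith_mean \<xi> (Suc n) \<le> arith_mean \<xi> n" if n: "n \<ge> 1" for n
  proof -
    \<comment> \<open>The new entry is at most the average of the earlier ones, so it cannot raise the mean.\<close>
    have "real n * \<xi> (Suc n) = (\<Sum>j=1..n. \<xi> (Suc n))" by simp
    also have "\<dots> \<le> (\<Sum>j=1..n. \<xi> j)"
      by (intro sum_mono monotone_onD[OF assms]) auto
    finally have "real n * (\<Sum>j=1..Suc n. \<xi> j) \<le> real (Suc n) * (\<Sum>j=1..n. \<xi> j)"
      by (simp add: algebra_simps)
    then show ?thesis
      using n by (simp add: arith_mean_def field_simps)
  qed
  show ?thesis
  proof (rule monotone_onI)
    fix m n :: nat
    assume "m \<in> {1..}" and "m \<le> n"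
    from \<open>m \<le> n\<close> show "arith_mean \<xi> n \<le> arith_mean \<xi> m"
    proof (induction n rule: dec_induct)
      case (step k)
      have "k \<ge> 1" using step.hyps \<open>m \<in> {1..}\<close> by auto
      then show ?case
        using mean_Suc[of k] step.IH by linarith
    qed simp
  qed
qed

text \<open>
  Cesaro's theorem for the limit 0: beyond some \<open>N\<close> all entries are below \<open>e / 2\<close> in absolute
  value, and the fixed sum of the first \<open>N\<close> absolute values is negligible after division
  by \<open>n\<close>.
\<close>

lemma arith_mean_tendsto_zero:
  assumes "\<xi> \<longlonglongrightarrow> 0"
  shows "arith_mean \<xi> \<longlonglongrightarrow> 0"
proof (rule LIMSEQ_I)
  fix e :: real
  assume e: "0 < e"
  obtain N where N: "\<And>n. n \<ge> N \<Longrightarrow> \<bar>\<xi> n\<bar> < e / 2"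
    using LIMSEQ_D[OF assms, of "e / 2"] e by auto
  define A where "A = (\<Sum>j=1..N. \<bar>\<xi> j\<bar>)"
  obtain M :: nat where M: "2 * A / e < real M" using reals_Archimedean2 by blast
  have "norm (arith_mean \<xi> n - 0) < e" if n: "n \<ge> Suc (max N M)" for n
  proof -
    have "\<bar>\<Sum>j=1..n. \<xi> j\<bar> \<le> (\<Sum>j=1..n. \<bar>\<xi> j\<bar>)" by (rule sum_abs)
    also have "\<dots> = A + (\<Sum>j=Suc N..n. \<bar>\<xi> j\<bar>)"
      unfolding A_def using n sum.ub_add_nat[of 1 N "\<lambda>j. \<bar>\<xi> j\<bar>" "n - N"] by simp
    also have "(\<Sum>j=Suc N..n. \<bar>\<xi> j\<bar>) \<le> (\<Sum>j=Suc N..n. e / 2)"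
      using N by (intro sum_mono) (auto intro: less_imp_le)
    also have "\<dots> \<le> real n * (e / 2)"
      using e by (simp add: mult_right_mono)
    also have "A < real n * (e / 2)"
    proof -
      have "2 * A / e < real n" using M n by linarith
      then show ?thesis using e by (simp add: field_simps)
    qed
    finally have "\<bar>\<Sum>j=1..n. \<xi> j\<bar> < e * real n" by (simp add: mult.commute)
    then show ?thesis
      using n by (simp add: arith_mean_def abs_mult pos_divide_less_eq)
  qed
  then show "\<exists>no. \<forall>n\<ge>no. norm (arith_mean \<xi> n - 0) < e" by blast
qed

lemma arith_mean_c0star:
  assumes "\<xi> \<in> c0star"
  shows "arith_mean \<xi> \<in> c0star"
  using assms arith_mean_nonneg antimono_on_arith_mean arith_mean_tendsto_zero
  unfolding c0star_def by blast

lemma c0star_first_pos: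
  assumes "\<xi> \<in> c0star" and "nonzero_seq \<xi>"
  shows "0 < \<xi> 1"
proof -
  obtain n where n: "n \<ge> 1" "\<xi> n \<noteq> 0" using assms(2) by (auto simp: nonzero_seq_def)
  have "0 < \<xi> n" using assms(1) n by (auto simp: c0star_def order_less_le)
  also have "\<xi> n \<le> \<xi> 1"
    using assms(1) n by (auto simp: c0star_def intro: monotone_onD[of "{1..}"])
  finally show ?thesis .
qed

lemma nonzero_seq_arith_mean:
  assumes "\<xi> \<in> c0star" and "nonzero_seq \<xi>"
  shows "nonzero_seq (arith_mean \<xi>)"
  unfolding nonzero_seq_def
  using c0star_first_pos[OF assms] by (intro exI[of _ 1]) (simp add: arith_mean_def)

lemma c0star_sum_pos:
  assumes "\<xi> \<in> c0star" and "nonzero_seq \<xi>" and "m \<ge> 1"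
  shows "0 < (\<Sum>j=1..m. \<xi> j)"
proof (rule sum_pos2[of _ 1])
  show "0 < \<xi> 1" using c0star_first_pos assms by blast
qed (use assms in \<open>auto simp: c0star_def\<close>)

lemma exp_Delta2_iff_sum_bound:
  assumes "\<xi> \<in> c0star" and "nonzero_seq \<xi>"
  shows "exp_Delta2 \<xi> \<longleftrightarrow> (\<exists>c. \<forall>m\<ge>1. (\<Sum>j=1..m\<^sup>2. \<xi> j) \<le> c * (\<Sum>j=1..m. \<xi> j))"
  unfolding exp_Delta2_def mult_arith_mean
  using assms c0star_sum_pos[OF assms]
  by (auto simp: bdd_above_def pos_divide_le_eq)

text \<open>
  The square blocks cover the indices below \<open>(m + 1)\<^sup>2\<close>; stopping there rather than at \<open>m\<^sup>2\<close> lets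
  the induction on \<open>m\<close> add exactly one block to the left and one term to the right.
\<close>

lemma sum_arith_mean_square_blocks:
  assumes anti: "antimono_on {1..} \<xi>"
    and bound: "\<And>k. k \<ge> 1 \<Longrightarrow> (\<Sum>j=1..k\<^sup>2. \<xi> j) \<le> c * (\<Sum>j=1..k. \<xi> j)"
    and nonneg: "\<And>n. n \<ge> 1 \<Longrightarrow> 0 \<le> \<xi> n"
  shows "(\<Sum>i=1..<(Suc m)\<^sup>2. arith_mean \<xi> i) \<le> 3 * c * (\<Sum>k=1..m. arith_mean \<xi> k)"
proof (induction m)
  case (Suc m)
  define k where "k = Suc m"
  have k: "k \<ge> 1" by (simp add: k_def)
  have split: "(Suc k)\<^sup>2 = k\<^sup>2 + (2 * k + 1)" by (simp add: power2_eq_square)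
  have "(\<Sum>i=k\<^sup>2..<(Suc k)\<^sup>2. arith_mean \<xi> i) \<le> (\<Sum>i=k\<^sup>2..<(Suc k)\<^sup>2. arith_mean \<xi> (k\<^sup>2))"
    using k by (intro sum_mono monotone_onD[OF antimono_on_arith_mean[OF anti]])
      (auto intro: order_trans[of "Suc 0" "k\<^sup>2"])
  also have "\<dots> = (2 * real k + 1) * arith_mean \<xi> (k\<^sup>2)"
    by (simp add: split)
  also have "\<dots> \<le> 3 * real k * arith_mean \<xi> (k\<^sup>2)"
    using k arith_mean_nonneg[OF nonneg] by (intro mult_right_mono) auto
  also have "\<dots> = 3 / real k * (\<Sum>j=1..k\<^sup>2. \<xi> j)"
    using k by (simp add: arith_mean_def power2_eq_square)
  also have "\<dots> \<le> 3 / real k * (c * (\<Sum>j=1..k. \<xi> j))"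
    by (intro mult_left_mono bound k) auto
  also have "\<dots> = 3 * c * arith_mean \<xi> k" by (simp add: arith_mean_def)
  finally have block: "(\<Sum>i=k\<^sup>2..<(Suc k)\<^sup>2. arith_mean \<xi> i) \<le> 3 * c * arith_mean \<xi> k" .
  have "(\<Sum>i=1..<(Suc k)\<^sup>2. arith_mean \<xi> i)
      = (\<Sum>i=1..<k\<^sup>2. arith_mean \<xi> i) + (\<Sum>i=k\<^sup>2..<(Suc k)\<^sup>2. arith_mean \<xi> i)"
    using k by (intro sum.atLeastLessThan_concat[symmetric]) (auto simp: split)
  also have "\<dots> \<le> 3 * c * (\<Sum>j=1..m. arith_mean \<xi> j) + 3 * c * arith_mean \<xi> k"
    using Suc.IH block by (simp add: k_def)
  also have "\<dots> = 3 * c * (\<Sum>j=1..k. arith_mean \<xi> j)"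
    by (simp add: k_def algebra_simps)
  finally show ?case by (simp add: k_def)
qed simp

lemma exp_Delta2_arith_mean:
  assumes "exp_Delta2 \<xi>"
  shows "exp_Delta2 (arith_mean \<xi>)"
proof -
  have \<xi>: "\<xi> \<in> c0star" "nonzero_seq \<xi>" using assms by (auto simp: exp_Delta2_def)
  obtain c where c: "\<And>m. m \<ge> 1 \<Longrightarrow> (\<Sum>j=1..m\<^sup>2. \<xi> j) \<le> c * (\<Sum>j=1..m. \<xi> j)"
    using assms exp_Delta2_iff_sum_bound[OF \<xi>] by blast
  have anti: "antimono_on {1..} \<xi>" and nonneg: "\<And>n. n \<ge> 1 \<Longrightarrow> 0 \<le> \<xi> n"
    using \<xi>(1) by (auto simp: c0star_def)
  have "(\<Sum>i=1..m\<^sup>2. arith_mean \<xi> i) \<le> 3 * c * (\<Sum>i=1..m. arith_mean \<xi> i)" for m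
  proof -
    have "(\<Sum>i=1..m\<^sup>2. arith_mean \<xi> i) \<le> (\<Sum>i=1..<(Suc m)\<^sup>2. arith_mean \<xi> i)"
      by (intro sum_mono2)
        (auto simp: power2_eq_square intro: arith_mean_nonneg[OF nonneg])
    also have "\<dots> \<le> 3 * c * (\<Sum>i=1..m. arith_mean \<xi> i)"
      by (rule sum_arith_mean_square_blocks[OF anti c nonneg])
    finally show ?thesis .
  qed
  then show ?thesis
    using exp_Delta2_iff_sum_bound[OF arith_mean_c0star nonzero_seq_arith_mean] \<xi> by blast
qed

theorem corollary3p12:
  fixes \<eta> :: "nat \<Rightarrow> real" and p :: nat
  assumes "\<eta> \<in> c0star"
    and "nonzero_seq \<eta>"
    and "exp_Delta2 \<eta>"
  shows "exp_Delta2 ((arith_mean ^^ p) \<eta>)"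
  using assms(3) by (induction p) (auto intro: exp_Delta2_arith_mean)

end
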